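(* Let $\Delta$ be a domain (connected open subset) in $\mathbb{C}$, let $n$ be a positive integer, and let $t_1,t_2:\Delta\rightarrow\mathcal{G}r(n,\mathcal{H}_q)$ be two right holomorphic curves satisfying $\bigvee_{\mathbb{H}}\{t_1(\omega);\ \omega\in\Delta\}=\bigvee_{\mathbb{H}}\{t_2(\omega);\ \omega\in\Delta\}=\mathcal{H}_q$. Then $t_1$ and $t_2$ are congruent if and only if $E_{t_1}$ and $E_{t_2}$ are equivalent as Hermitian right holomorphic quaternionic vector bundles over $\Delta$.
   Context: $\mathbb{H}$ denotes the quaternions with units $\boldsymbol{i},\boldsymbol{j},\boldsymbol{k}$; $\mathbb{C}$ is identified with $\{a+b\boldsymbol{i}:a,b\in\mathbb{R}\}\subset\mathbb{H}$. $\mathcal{H}_q$ is a separable quaternionic Hilbert space: a right $\mathbb{H}$-vector space with countable orthonormal basis, complete for the norm of an inner product $\langle\cdot,\cdot\rangle_{\mathbb{H}}$ with values in $\mathbb{H}$ satisfying $\langle x,y\rangle_{\mathbb H}=\overline{\langle y,x\rangle_{\mathbb H}}$, $\langle xp+yq,z\rangle_{\mathbb H}=\langle x,z\rangle_{\mathbb H}p+\langle y,z\rangle_{\mathbb H}q$ and positive definiteness. For $F\subseteq\mathcal{H}_q$, $\bigvee_{\mathbb{H}}F$ is the closure of the right $\mathbb{H}$-linear span of $F$ (for a family of subspaces, of their union). A quaternionic unitary operator is a bounded right $\mathbb{H}$-linear operator $U$ with $U^*U=UU^*=\boldsymbol{I}$. A map $\gamma$ from an open set of $\mathbb{C}$ to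 $\mathcal{H}_q$ is right holomorphic if $\gamma'(z)=\lim_{h\to0}(\gamma(z+h)-\gamma(z))h^{-1}$ exists (with $h\in\mathbb{C}\setminus\{0\}$ acting by right multiplication) at every point; $\gamma^{(m)}$ is the $m$-th such derivative, $\gamma^{(0)}=\gamma$. $\mathcal{G}r(n,\mathcal{H}_q)$ is the set of all $n$-dimensional right $\mathbb{H}$-subspaces of $\mathcal{H}_q$. A map $t:\Delta\to\mathcal{G}r(n,\mathcal{H}_q)$ is a right holomorphic curve if every $\omega_0\in\Delta$ has an open neighbourhood $\Delta_0$ and right holomorphic maps $\gamma_1,\dots,\gamma_n:\Delta_0\to\mathcal{H}_q$ such that $\{\gamma_i(\omega)\}_{i=1}^n$ is a basis of $t(\omega)$ for all $\omega\in\Delta_0$. A right holomorphic cross-section of $t$ (or of $E_t$) over an open set $\Delta_0\subseteq\Delta$ is a right holomorphic map $\gamma:\Delta_0\to\mathcal{H}_q$ with $\gamma(\omega)\in t(\omega)$ for all $\omega\in\Delta_0$. The associated $n$-dimensional Hermitian right holomorphic quaternionic vector bundle is $E_t=\{(x,\omega):\ x\in t(\omega),\ \omega\in\Delta\}$ with projection $\pi(x,\omega)=\omega$. $t_1,t_2$ are congruent if there is a quaternionic unitary operator $U$ on $\mathcal{H}_q$ with $t_2=Ut_1$, i.e. $t_2(\omega)=U(t_1(\omega))$ for all $\omega\in\Delta$. $E_{t_1}$ and $E_{t_2}$ are equivalent as Hermitian right holomorphic quaternionic vector bundles if there is a (fibre-preserving) bundle map $\Phi:E_{t_1}\to E_{t_2}$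 such that: (1) for any $\omega\in\Delta$, $\Phi|_{t_1(\omega)}:t_1(\omega)\to t_2(\omega)$ is a quaternionic right linear isomorphism; (2) for any right holomorphic cross-section $\gamma$ in $E_{t_1}$, $\Phi(\gamma)$ is a right holomorphic cross-section in $E_{t_2}$; (3) for any right holomorphic cross-sections $\gamma,\widetilde\gamma$ in $E_{t_1}$ (over the same open set) and all integers $m\ge0$, $\langle\gamma^{(m)},\widetilde\gamma\rangle_{\mathbb{H}}=\langle(\Phi(\gamma))^{(m)},\Phi(\widetilde\gamma)\rangle_{\mathbb{H}}$. *)

theory Defs
  imports "HOL-Analysis.Analysis"
begin

section \<open>Quaternions\<close>

datatype quat = Quat (qRe: real) (qIm1: real) (qIm2: real) (qIm3: real)

instantiation quat :: ring_1
begin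

definition zero_quat :: quat where "0 = Quat 0 0 0 0"

definition one_quat :: quat where "1 = Quat 1 0 0 0"

definition plus_quat :: "quat \<Rightarrow> quat \<Rightarrow> quat" where
  "p + q = Quat (qRe p + qRe q) (qIm1 p + qIm1 q) (qIm2 p + qIm2 q) (qIm3 p + qIm3 q)"

definition minus_quat :: "quat \<Rightarrow> quat \<Rightarrow> quat" where
  "p - q = Quat (qRe p - qRe q) (qIm1 p - qIm1 q) (qIm2 p - qIm2 q) (qIm3 p - qIm3 q)"

definition uminus_quat :: "quat \<Rightarrow> quat" where
  "- p = Quat (- qRe p) (- qIm1 p) (- qIm2 p) (- qIm3 p)"

definition times_quat :: "quat \<Rightarrow> quat \<Rightarrow> quat" where
  "p * q = Quat
     (qRe p * qRe q - qIm1 p * qIm1 q - qIm2 p * qIm2 q - qIm3 p * qIm3 q)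
     (qRe p * qIm1 q + qIm1 p * qRe q + qIm2 p * qIm3 q - qIm3 p * qIm2 q)
     (qRe p * qIm2 q - qIm1 p * qIm3 q + qIm2 p * qRe q + qIm3 p * qIm1 q)
     (qRe p * qIm3 q + qIm1 p * qIm2 q - qIm2 p * qIm1 q + qIm3 p * qRe q)"

instance
  by standard
    (auto simp: zero_quat_def one_quat_def plus_quat_def minus_quat_def uminus_quat_def
      times_quat_def algebra_simps)

end

lemma quat_units:
  defines "i \<equiv> Quat 0 1 0 0" and "j \<equiv> Quat 0 0 1 0" and "k \<equiv> Quat 0 0 0 1"
  shows "i * i = - 1" "j * j = - 1" "k * k = - 1"
    "i * j = k" "j * k = i" "k * i = j" "j * i = - k" "k * j = - i" "i * k = - j"
  by (simp_all add: i_def j_def k_def times_quat_def one_quat_def uminus_quat_def)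

definition qcnj :: "quat \<Rightarrow> quat" where
  "qcnj q = Quat (qRe q) (- qIm1 q) (- qIm2 q) (- qIm3 q)"

definition quat_of_real :: "real \<Rightarrow> quat" where
  "quat_of_real r = Quat r 0 0 0"

definition quat_of_complex :: "complex \<Rightarrow> quat" where
  "quat_of_complex z = Quat (Re z) (Im z) 0 0"


section \<open>Quaternionic Hilbert spaces\<close>

class quat_scale =
  fixes scaleQ :: "'a \<Rightarrow> quat \<Rightarrow> 'a"  (infixl \<open>*\<^sub>Q\<close> 75)

class right_quat_vector = ab_group_add + quat_scale +
  assumes scaleQ_add_left: "(x + y) *\<^sub>Q q = x *\<^sub>Q q + y *\<^sub>Q q"
    and scaleQ_add_right: "x *\<^sub>Q (p + q) = x *\<^sub>Q p + x *\<^sub>Q q"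
    and scaleQ_scaleQ: "(x *\<^sub>Q p) *\<^sub>Q q = x *\<^sub>Q (p * q)"
    and scaleQ_one: "x *\<^sub>Q 1 = x"

definition qsubspace :: "'a::right_quat_vector set \<Rightarrow> bool" where
  "qsubspace S \<longleftrightarrow> 0 \<in> S \<and> (\<forall>x\<in>S. \<forall>y\<in>S. x + y \<in> S) \<and> (\<forall>x\<in>S. \<forall>q. x *\<^sub>Q q \<in> S)"

definition qspan :: "'a::right_quat_vector set \<Rightarrow> 'a set" where
  "qspan B = {\<Sum>b\<in>F. b *\<^sub>Q c b | F c. finite F \<and> F \<subseteq> B}"

text \<open>Bases are indexed families; independence of the family includes that its members are
  pairwise distinct.\<close>

definition qbasis :: "nat \<Rightarrow> (nat \<Rightarrow> 'a::right_quat_vector) \<Rightarrow> 'a set \<Rightarrow> bool" where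
  "qbasis n v S \<longleftrightarrow>
     (\<forall>c. (\<Sum>i<n. v i *\<^sub>Q c i) = 0 \<longrightarrow> (\<forall>i<n. c i = 0)) \<and> qspan (v ` {..<n}) = S"

definition grassmannian :: "nat \<Rightarrow> 'a::right_quat_vector set set" where
  "grassmannian n = {S. qsubspace S \<and> (\<exists>v. qbasis n v S)}"

text \<open>The real Banach space structure is the one underlying the quaternionic structure: real
  scalars act as real quaternions and the norm is the one of the inner product.  Since
  \<open>qinner x x\<close> is self-conjugate it is real, so positivity is a condition on its real part.\<close>

class quat_hilbert = right_quat_vector + banach +
  fixes qinner :: "'a \<Rightarrow> 'a \<Rightarrow> quat"
  assumes scaleR_eq_scaleQ: "r *\<^sub>R x = x *\<^sub>Q quat_of_real r"
    and qinner_commute: "qinner x y = qcnj (qinner y x)"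
    and qinner_linear_left: "qinner (x *\<^sub>Q p + y *\<^sub>Q q) z = qinner x z * p + qinner y z * q"
    and qinner_pos: "x \<noteq> 0 \<Longrightarrow> 0 < qRe (qinner x x)"
    and norm_eq_sqrt_qinner: "norm x = sqrt (qRe (qinner x x))"

definition orthonormal_qbasis :: "'a::quat_hilbert set \<Rightarrow> bool" where
  "orthonormal_qbasis B \<longleftrightarrow>
     (\<forall>x\<in>B. \<forall>y\<in>B. qinner x y = (if x = y then 1 else 0)) \<and> closure (qspan B) = UNIV"

definition bounded_qlinear :: "('a::quat_hilbert \<Rightarrow> 'a) \<Rightarrow> bool" where
  "bounded_qlinear U \<longleftrightarrow> bounded_linear U \<and> (\<forall>x q. U (x *\<^sub>Q q) = U x *\<^sub>Q q)"

definition is_qadjoint :: "('a::quat_hilbert \<Rightarrow> 'a) \<Rightarrow> ('a \<Rightarrow> 'a) \<Rightarrow> bool" where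
  "is_qadjoint U V \<longleftrightarrow> (\<forall>x y. qinner (U x) y = qinner x (V y))"

definition qunitary :: "('a::quat_hilbert \<Rightarrow> 'a) \<Rightarrow> bool" where
  "qunitary U \<longleftrightarrow> bounded_qlinear U \<and>
     (\<exists>V. bounded_qlinear V \<and> is_qadjoint U V \<and> V \<circ> U = id \<and> U \<circ> V = id)"


section \<open>Right holomorphic maps, curves and bundles\<close>

definition right_quotient :: "(complex \<Rightarrow> 'a::quat_hilbert) \<Rightarrow> complex \<Rightarrow> complex \<Rightarrow> 'a" where
  "right_quotient \<gamma> z h = (\<gamma> (z + h) - \<gamma> z) *\<^sub>Q quat_of_complex (inverse h)"

definition right_deriv :: "(complex \<Rightarrow> 'a::quat_hilbert) \<Rightarrow> complex \<Rightarrow> 'a" where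
  "right_deriv \<gamma> z = Lim (at 0) (right_quotient \<gamma> z)"

text \<open>Maps on an open set \<open>D\<close> are represented by total functions.  At points of \<open>D\<close> the iterated
  derivatives \<open>(right_deriv ^^ m) \<gamma>\<close> depend only on the values of \<open>\<gamma>\<close> on \<open>D\<close>.\<close>

definition right_holomorphic_on :: "(complex \<Rightarrow> 'a::quat_hilbert) \<Rightarrow> complex set \<Rightarrow> bool" where
  "right_holomorphic_on \<gamma> D \<longleftrightarrow>
     open D \<and> (\<forall>z\<in>D. \<exists>d. (right_quotient \<gamma> z \<longlongrightarrow> d) (at 0))"

definition right_holomorphic_curve ::
    "nat \<Rightarrow> complex set \<Rightarrow> (complex \<Rightarrow> 'a::quat_hilbert set) \<Rightarrow> bool" where
  "right_holomorphic_curve n \<Delta> t \<longleftrightarrow>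
     (\<forall>\<omega>\<in>\<Delta>. t \<omega> \<in> grassmannian n) \<and>
     (\<forall>\<omega>\<^sub>0\<in>\<Delta>. \<exists>\<Delta>\<^sub>0 \<gamma>. open \<Delta>\<^sub>0 \<and> \<omega>\<^sub>0 \<in> \<Delta>\<^sub>0 \<and> \<Delta>\<^sub>0 \<subseteq> \<Delta> \<and>
        (\<forall>i<n. right_holomorphic_on (\<gamma> i) \<Delta>\<^sub>0) \<and>
        (\<forall>\<omega>\<in>\<Delta>\<^sub>0. qbasis n (\<lambda>i. \<gamma> i \<omega>) (t \<omega>)))"

definition congruent_curves ::
    "complex set \<Rightarrow> (complex \<Rightarrow> 'a::quat_hilbert set) \<Rightarrow> (complex \<Rightarrow> 'a set) \<Rightarrow> bool" where
  "congruent_curves \<Delta> t\<^sub>1 t\<^sub>2 \<longleftrightarrow> (\<exists>U. qunitary U \<and> (\<forall>\<omega>\<in>\<Delta>. t\<^sub>2 \<omega> = U ` t\<^sub>1 \<omega>))"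

definition total_space :: "complex set \<Rightarrow> (complex \<Rightarrow> 'a set) \<Rightarrow> ('a \<times> complex) set" where
  "total_space \<Delta> t = {(x, \<omega>). x \<in> t \<omega> \<and> \<omega> \<in> \<Delta>}"

definition cross_section ::
    "complex set \<Rightarrow> (complex \<Rightarrow> 'a::quat_hilbert set) \<Rightarrow> complex set \<Rightarrow> (complex \<Rightarrow> 'a) \<Rightarrow> bool" where
  "cross_section \<Delta> t \<Delta>\<^sub>0 \<gamma> \<longleftrightarrow>
     open \<Delta>\<^sub>0 \<and> \<Delta>\<^sub>0 \<subseteq> \<Delta> \<and> right_holomorphic_on \<gamma> \<Delta>\<^sub>0 \<and> (\<forall>\<omega>\<in>\<Delta>\<^sub>0. \<gamma> \<omega> \<in> t \<omega>)"

text \<open>The bundle projection is \<open>snd\<close>; the total spaces carry the topology induced from the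
  product.\<close>

definition bundle_map ::
    "complex set \<Rightarrow> (complex \<Rightarrow> 'a::quat_hilbert set) \<Rightarrow> (complex \<Rightarrow> 'a set) \<Rightarrow>
     ('a \<times> complex \<Rightarrow> 'a \<times> complex) \<Rightarrow> bool" where
  "bundle_map \<Delta> t\<^sub>1 t\<^sub>2 \<Phi> \<longleftrightarrow>
     \<Phi> ` total_space \<Delta> t\<^sub>1 \<subseteq> total_space \<Delta> t\<^sub>2 \<and>
     continuous_on (total_space \<Delta> t\<^sub>1) \<Phi> \<and>
     (\<forall>p\<in>total_space \<Delta> t\<^sub>1. snd (\<Phi> p) = snd p)"

definition fibre_map :: "('a \<times> complex \<Rightarrow> 'a \<times> complex) \<Rightarrow> complex \<Rightarrow> 'a \<Rightarrow> 'a" where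
  "fibre_map \<Phi> \<omega> x = fst (\<Phi> (x, \<omega>))"

definition map_section ::
    "('a \<times> complex \<Rightarrow> 'a \<times> complex) \<Rightarrow> (complex \<Rightarrow> 'a) \<Rightarrow> complex \<Rightarrow> 'a" where
  "map_section \<Phi> \<gamma> \<omega> = fibre_map \<Phi> \<omega> (\<gamma> \<omega>)"

definition qlinear_iso_on ::
    "('a::right_quat_vector \<Rightarrow> 'a) \<Rightarrow> 'a set \<Rightarrow> 'a set \<Rightarrow> bool" where
  "qlinear_iso_on f S T \<longleftrightarrow>
     bij_betw f S T \<and>
     (\<forall>x\<in>S. \<forall>y\<in>S. f (x + y) = f x + f y) \<and> (\<forall>x\<in>S. \<forall>q. f (x *\<^sub>Q q) = f x *\<^sub>Q q)"

definition equivalent_bundles ::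
    "complex set \<Rightarrow> (complex \<Rightarrow> 'a::quat_hilbert set) \<Rightarrow> (complex \<Rightarrow> 'a set) \<Rightarrow> bool" where
  "equivalent_bundles \<Delta> t\<^sub>1 t\<^sub>2 \<longleftrightarrow>
     (\<exists>\<Phi>. bundle_map \<Delta> t\<^sub>1 t\<^sub>2 \<Phi> \<and>
        (\<forall>\<omega>\<in>\<Delta>. qlinear_iso_on (fibre_map \<Phi> \<omega>) (t\<^sub>1 \<omega>) (t\<^sub>2 \<omega>)) \<and>
        (\<forall>\<Delta>\<^sub>0 \<gamma>. cross_section \<Delta> t\<^sub>1 \<Delta>\<^sub>0 \<gamma> \<longrightarrow> cross_section \<Delta> t\<^sub>2 \<Delta>\<^sub>0 (map_section \<Phi> \<gamma>)) \<and>
        (\<forall>\<Delta>\<^sub>0 \<gamma> \<eta>. cross_section \<Delta> t\<^sub>1 \<Delta>\<^sub>0 \<gamma> \<longrightarrow> cross_section \<Delta> t\<^sub>1 \<Delta>\<^sub>0 \<eta> \<longrightarrow>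
           (\<forall>m. \<forall>\<omega>\<in>\<Delta>\<^sub>0.
              qinner ((right_deriv ^^ m) \<gamma> \<omega>) (\<eta> \<omega>) =
              qinner ((right_deriv ^^ m) (map_section \<Phi> \<gamma>) \<omega>) (map_section \<Phi> \<eta> \<omega>))))"

end

theory Submission
  imports Defs "HOL-Complex_Analysis.Complex_Analysis"
begin

text \<open>
  A unitary \<open>U\<close> with \<open>t\<^sub>2 = U t\<^sub>1\<close> acts fibrewise, commutes with the derivatives \<open>\<gamma> \<mapsto> \<gamma>\<^sup>(\<^sup>m\<^sup>)\<close> and
  preserves inner products, so \<open>(x, \<omega>) \<mapsto> (U x, \<omega>)\<close> is an equivalence of the bundles.  Only one point
  is not formal: the derivatives of all orders must exist, since otherwise \<open>right_deriv\<close> is an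
  arbitrary value that \<open>U\<close> need not respect.  Hence right holomorphic maps have to be shown to be
  infinitely differentiable (\<open>right_holomorphic_on_right_deriv\<close>).  This is reduced to scalar complex
  analysis: \<open>cinner\<close>, the \<open>\<complex>\<close>-part of the inner product, is \<open>\<complex>\<close>-linear in its first argument for
  right multiplication by \<open>\<complex>\<close>, so \<open>w \<mapsto> cinner (\<gamma> w) y\<close> is an ordinary holomorphic function.  Cauchy's
  estimates for these functions are uniform in the unit vectors \<open>y\<close>, and this uniformity upgrades
  weak convergence of the difference quotients of \<open>\<gamma>'\<close> to convergence in norm.

  Conversely, let \<open>\<Phi>\<close> be an equivalence.  It suffices that
  \<open>\<langle>x, y\<rangle> = \<langle>\<Phi> x, \<Phi> y\<rangle>\<close> for \<open>x \<in> t\<^sub>1 \<omega>\<close> and \<open>y \<in> t\<^sub>1 \<omega>'\<close> with \<^emph>\<open>arbitrary\<close> \<open>\<omega>, \<omega>' \<in> \<Delta>\<close>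
  (\<open>fibre_maps_preserve_qinner\<close>): then \<open>x \<mapsto> \<Phi> x\<close> is an isometric relation between two sets with dense
  spans, and it extends by linearity and continuity to a unitary operator
  (\<open>isometric_relation_extends_to_qunitary\<close>).
  To compare the inner products, fix \<open>\<omega>'\<close> and \<open>y\<close>.  For a local frame \<open>\<gamma>\<^sub>i\<close> around \<open>\<omega>'\<close>, the functions
  \<open>w \<mapsto> \<langle>\<gamma>\<^sub>i w, y\<rangle>\<close> and \<open>w \<mapsto> \<langle>\<Phi> (\<gamma>\<^sub>i w), \<Phi> y\<rangle>\<close> have the same derivatives of every order at \<open>\<omega>'\<close>;
  this is exactly the derivative condition on \<open>\<Phi>\<close>, because \<open>y\<close> is a combination of the \<open>\<gamma>\<^sub>j \<omega>'\<close>.  So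
  they agree near \<open>\<omega>'\<close>.  By the identity theorem, agreement near one point of a disc with a frame
  gives agreement on the whole disc, and connectedness of \<open>\<Delta>\<close> carries it to every \<open>\<omega>\<close>.
\<close>

section \<open>Quaternionic inner products\<close>

lemmas quat_simps = zero_quat_def one_quat_def plus_quat_def minus_quat_def uminus_quat_def
  times_quat_def qcnj_def quat_of_real_def quat_of_complex_def

lemma qcnj_add: "qcnj (p + q) = qcnj p + qcnj q"
  by (simp add: quat_simps)

lemma qcnj_mult: "qcnj (p * q) = qcnj q * qcnj p"
  by (simp add: quat_simps algebra_simps)

lemma scaleQ_zero [simp]: "(x::'a::right_quat_vector) *\<^sub>Q 0 = 0"
  using scaleQ_add_right[of x 0 0] by simp

lemma zero_scaleQ [simp]: "(0::'a::right_quat_vector) *\<^sub>Q q = 0"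
  using scaleQ_add_left[of 0 0 q] by simp

lemma scaleQ_minus_one: "x *\<^sub>Q (- 1) = - (x::'a::right_quat_vector)"
  using scaleQ_add_right[of x "- 1" 1] by (simp add: scaleQ_one eq_neg_iff_add_eq_0)

lemma qinner_add_left: "qinner (x + y) z = qinner x z + qinner y z"
  using qinner_linear_left[of x 1 y 1 z] by (simp add: scaleQ_one)

lemma qinner_scaleQ_left: "qinner (x *\<^sub>Q p) z = qinner x z * p"
  using qinner_linear_left[of x p 0 0 z] by simp

lemma qinner_add_right: "qinner x (y + z) = qinner x y + qinner x z"
  by (metis qcnj_add qinner_add_left qinner_commute)

lemma qinner_scaleQ_right: "qinner x (y *\<^sub>Q q) = qcnj q * qinner x y"
  by (metis qcnj_mult qinner_scaleQ_left qinner_commute)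

lemma qinner_zero_left [simp]: "qinner 0 y = 0"
  using qinner_scaleQ_left[of 0 0 y] by simp

lemma qinner_zero_right [simp]: "qinner x 0 = 0"
  using qinner_add_right[of x 0 0] by simp

lemma norm_sq_eq_qinner: "(norm (x::'a::quat_hilbert))\<^sup>2 = qRe (qinner x x)"
proof (cases "x = 0")
  case True
  then show ?thesis by (simp add: quat_simps)
next
  case False
  then show ?thesis using qinner_pos[of x] by (simp add: norm_eq_sqrt_qinner)
qed

lemma qinner_self: "qinner x x = quat_of_real ((norm (x::'a::quat_hilbert))\<^sup>2)"
proof (cases "qinner x x")
  case (Quat a b c d)
  have "Quat a b c d = qcnj (Quat a b c d)"
    using qinner_commute[of x x] unfolding Quat .
  with Quat show ?thesis
    by (simp add: norm_sq_eq_qinner quat_simps)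
qed

lemma norm_scaleQ:
  "norm ((x::'a::quat_hilbert) *\<^sub>Q q) = norm x * sqrt ((qRe q)\<^sup>2 + (qIm1 q)\<^sup>2 + (qIm2 q)\<^sup>2 + (qIm3 q)\<^sup>2)"
proof -
  have "(norm (x *\<^sub>Q q))\<^sup>2 = (norm x)\<^sup>2 * ((qRe q)\<^sup>2 + (qIm1 q)\<^sup>2 + (qIm2 q)\<^sup>2 + (qIm3 q)\<^sup>2)"
    unfolding norm_sq_eq_qinner[of "x *\<^sub>Q q"] qinner_scaleQ_left qinner_scaleQ_right
    by (simp add: qinner_self, simp add: quat_simps algebra_simps power2_eq_square)
  also have "\<dots> = (norm x * sqrt ((qRe q)\<^sup>2 + (qIm1 q)\<^sup>2 + (qIm2 q)\<^sup>2 + (qIm3 q)\<^sup>2))\<^sup>2"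
    by (simp add: power_mult_distrib)
  finally show ?thesis
    by (rule power2_eq_imp_eq) simp_all
qed

lemma norm_scaleQ_complex:
  "norm ((x::'a::quat_hilbert) *\<^sub>Q quat_of_complex z) = norm x * cmod z"
  by (simp add: norm_scaleQ quat_of_complex_def cmod_def)

lemma bounded_linear_scaleQ: "bounded_linear (\<lambda>x::'a::quat_hilbert. x *\<^sub>Q q)"
proof (rule bounded_linear_intro[where K = "sqrt ((qRe q)\<^sup>2 + (qIm1 q)\<^sup>2 + (qIm2 q)\<^sup>2 + (qIm3 q)\<^sup>2)"])
  show "(r *\<^sub>R x) *\<^sub>Q q = r *\<^sub>R (x *\<^sub>Q q)" for r and x :: 'a
    by (simp add: scaleR_eq_scaleQ scaleQ_scaleQ quat_simps mult.commute)
qed (simp_all add: scaleQ_add_left norm_scaleQ)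

lemma qRe_qinner_polarization:
  "2 * qRe (qinner x y) = (norm (x + y))\<^sup>2 - (norm x)\<^sup>2 - (norm (y::'a::quat_hilbert))\<^sup>2"
proof -
  have "qRe (qinner y x) = qRe (qinner x y)"
    by (subst qinner_commute) (simp add: qcnj_def)
  then show ?thesis
    by (simp add: norm_sq_eq_qinner qinner_add_left qinner_add_right plus_quat_def)
qed

text \<open>
  The triangle inequality is part of the normed space structure, and by polarization it already
  contains the Cauchy--Schwarz inequality for the real part of the inner product.
\<close>
lemma abs_qRe_qinner_le: "\<bar>qRe (qinner x y)\<bar> \<le> norm x * norm (y::'a::quat_hilbert)"
proof -
  have le: "qRe (qinner x y) \<le> norm x * norm y" for x y :: 'a
  proof -
    have "(norm (x + y))\<^sup>2 \<le> (norm x + norm y)\<^sup>2"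
      by (intro power_mono norm_triangle_ineq) simp
    then show ?thesis
      using qRe_qinner_polarization[of x y] by (simp add: power2_sum)
  qed
  have "qinner (x *\<^sub>Q - 1) y = - qinner x y"
    by (simp add: qinner_scaleQ_left)
  moreover have "norm (x *\<^sub>Q - 1) = norm x"
    by (simp add: norm_scaleQ quat_simps)
  ultimately show ?thesis
    using le[of x y] le[of "x *\<^sub>Q - 1" y] by (simp add: uminus_quat_def)
qed

text \<open>
  Writing \<open>\<H> = \<complex> + j\<complex>\<close> as a right \<open>\<complex>\<close>-vector space, this is the first component of \<open>qinner\<close>; the
  second is recovered from \<open>cinner x (y j)\<close>, see \<open>qinner_eq_iff_cinner\<close>.
\<close>
definition cinner :: "'a::quat_hilbert \<Rightarrow> 'a \<Rightarrow> complex" where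
  "cinner x y = Complex (qRe (qinner x y)) (qIm1 (qinner x y))"

lemma cinner_add_left: "cinner (x + y) z = cinner x z + cinner y z"
  by (simp add: cinner_def qinner_add_left plus_quat_def complex_eq_iff)

lemma cinner_scaleQ_complex:
  "cinner (x *\<^sub>Q quat_of_complex z) y = cinner x y * z"
  by (simp add: cinner_def qinner_scaleQ_left quat_simps complex_eq_iff)

lemma qinner_eq_iff_cinner:
  "qinner x y = qinner x' y' \<longleftrightarrow>
     cinner x y = cinner x' y' \<and>
     cinner x (y *\<^sub>Q Quat 0 0 1 0) = cinner x' (y' *\<^sub>Q Quat 0 0 1 0)"
  by (auto simp: cinner_def qinner_scaleQ_right quat_simps quat.expand)

lemma cinner_scaleR: "cinner (r *\<^sub>R x) y = r *\<^sub>R cinner x y"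
  by (simp add: cinner_def scaleR_eq_scaleQ qinner_scaleQ_left quat_simps complex_eq_iff)

text \<open>
  The factor 2 comes from bounding real and imaginary part separately; any constant serves the
  estimates below.
\<close>
lemma cmod_cinner_le: "cmod (cinner x y) \<le> 2 * norm x * norm y"
proof -
  let ?i = "Quat 0 1 0 0"
  have "qRe (qinner (x *\<^sub>Q ?i) y) = - qIm1 (qinner x y)"
    by (simp add: qinner_scaleQ_left quat_simps)
  then have "\<bar>qIm1 (qinner x y)\<bar> \<le> norm x * norm y"
    using abs_qRe_qinner_le[of "x *\<^sub>Q ?i" y] by (simp add: norm_scaleQ)
  then show ?thesis
    using abs_qRe_qinner_le[of x y] cmod_le[of "cinner x y"] by (simp add: cinner_def)
qed

lemma bounded_linear_cinner: "bounded_linear (\<lambda>x. cinner x y)"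
  by (rule bounded_linear_intro[where K = "2 * norm y"])
    (use cmod_cinner_le[of _ y] in \<open>auto simp: cinner_add_left cinner_scaleR mult_ac\<close>)

lemma norm_sq_le_cinner: "(norm x)\<^sup>2 \<le> cmod (cinner x x)"
  using complex_Re_le_cmod[of "cinner x x"] by (simp add: cinner_def norm_sq_eq_qinner)

section \<open>Derivatives of right holomorphic maps\<close>

lemma right_quotient_cinner_deriv:
  assumes "(right_quotient \<gamma> z \<longlongrightarrow> d) (at 0)"
  shows "((\<lambda>w. cinner (\<gamma> w) y) has_field_derivative cinner d y) (at z)"
proof -
  interpret bounded_linear "\<lambda>x. cinner x y" by (rule bounded_linear_cinner)
  have "cinner (right_quotient \<gamma> z h) y = (cinner (\<gamma> (z + h)) y - cinner (\<gamma> z) y) / h" for h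
    by (simp add: right_quotient_def cinner_scaleQ_complex diff field_class.field_divide_inverse)
  with tendsto[OF assms] show ?thesis
    by (simp add: DERIV_def)
qed

lemma right_quotient_tendsto_right_deriv:
  assumes "right_holomorphic_on \<gamma> D" "z \<in> D"
  shows "(right_quotient \<gamma> z \<longlongrightarrow> right_deriv \<gamma> z) (at 0)"
proof -
  obtain d where "(right_quotient \<gamma> z \<longlongrightarrow> d) (at 0)"
    using assms by (auto simp: right_holomorphic_on_def)
  then show ?thesis
    by (simp add: right_deriv_def tendsto_Lim)
qed

lemma right_holomorphic_imp_continuous_on:
  assumes "right_holomorphic_on \<gamma> D"
  shows "continuous_on D \<gamma>"
proof (intro continuous_at_imp_continuous_on ballI)
  fix z assume "z \<in> D"
  have "((\<lambda>h. norm (right_quotient \<gamma> z h) * cmod h) \<longlongrightarrow> norm (right_deriv \<gamma> z) * cmod 0) (at 0)"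
    by (intro tendsto_intros right_quotient_tendsto_right_deriv[OF assms \<open>z \<in> D\<close>])
  moreover have "\<forall>\<^sub>F h in at 0. norm (right_quotient \<gamma> z h) * cmod h = norm (\<gamma> (z + h) - \<gamma> z)"
    unfolding eventually_at_filter
    by (simp add: right_quotient_def norm_scaleQ_complex norm_inverse)
  ultimately have "((\<lambda>h. norm (\<gamma> (z + h) - \<gamma> z)) \<longlongrightarrow> 0) (at 0)"
    using tendsto_cong by fastforce
  then have "((\<lambda>h. \<gamma> (z + h)) \<longlongrightarrow> \<gamma> z) (at 0)"
    using LIM_zero_iff tendsto_norm_zero_iff by blast
  then show "isCont \<gamma> z"
    by (simp add: isCont_iff)
qed

lemma right_holomorphic_on_subset:
  "right_holomorphic_on \<gamma> D \<Longrightarrow> open E \<Longrightarrow> E \<subseteq> D \<Longrightarrow> right_holomorphic_on \<gamma> E"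
  by (auto simp: right_holomorphic_on_def)

lemma cinner_holomorphic_on:
  assumes "right_holomorphic_on \<gamma> D"
  shows "(\<lambda>w. cinner (\<gamma> w) y) holomorphic_on D"
  using assms by (auto simp: right_holomorphic_on_def holomorphic_on_open
      intro: right_quotient_cinner_deriv)

lemma deriv_cinner:
  assumes "right_holomorphic_on \<gamma> D" "z \<in> D"
  shows "deriv (\<lambda>w. cinner (\<gamma> w) y) z = cinner (right_deriv \<gamma> z) y"
  by (rule DERIV_imp_deriv[OF right_quotient_cinner_deriv[OF
          right_quotient_tendsto_right_deriv[OF assms]]])

text \<open>
  A Taylor expansion of \<open>g'\<close> whose remainder is controlled by Cauchy's estimate for the third
  derivative of \<open>g\<close>.  The bound depends on \<open>g\<close> only through \<open>B\<close>, linearly: this makes it uniform over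
  the functions \<open>w \<mapsto> cinner (\<gamma> w) y\<close> with \<open>y\<close> in a bounded set.
\<close>
lemma deriv_quotient_bound:
  assumes g: "g holomorphic_on cball z (2 * r)" and r: "0 < r"
    and B: "\<And>w. w \<in> cball z (2 * r) \<Longrightarrow> cmod (g w) \<le> B"
    and h: "cmod h \<le> r" "h \<noteq> 0"
  shows "cmod ((deriv g (z + h) - deriv g z) / h - deriv (deriv g) z) \<le> 6 * B / r ^ 3 * cmod h"
proof -
  define f where "f m = (deriv ^^ m) (deriv g)" for m
  have sub: "cball w r \<subseteq> cball z (2 * r)" if "w \<in> cball z r" for w
  proof
    fix u assume "u \<in> cball w r"
    then show "u \<in> cball z (2 * r)"
      using that dist_triangle[of z u w] by simp
  qed
  have hol: "g holomorphic_on ball z (2 * r)"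
    using g by (rule holomorphic_on_subset) auto
  have der: "(f m has_field_derivative f (Suc m) w) (at w within cball z r)"
    if "w \<in> cball z r" for m w
  proof -
    have "f m holomorphic_on ball z (2 * r)"
      unfolding f_def by (intro holomorphic_higher_deriv holomorphic_deriv hol) auto
    moreover have "w \<in> ball z (2 * r)"
      using that r by auto
    ultimately have "(f m has_field_derivative deriv (f m) w) (at w)"
      by (intro holomorphic_derivI[of _ "ball z (2 * r)"]) auto
    then show ?thesis
      by (simp add: f_def has_field_derivative_at_within)
  qed
  have bound: "cmod (f (Suc 1) w) \<le> 6 * B / r ^ 3" if "w \<in> cball z r" for w
  proof -
    have "cmod ((deriv ^^ 3) g w) \<le> fact 3 * B / r ^ 3"
    proof (rule Cauchy_inequality)
      show "g holomorphic_on ball w r"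
        using g sub[OF that] ball_subset_cball by (blast intro: holomorphic_on_subset)
      show "continuous_on (cball w r) g"
        using g sub[OF that] by (blast intro: holomorphic_on_subset holomorphic_on_imp_continuous_on)
      show "cmod (g x) \<le> B" if "cmod (w - x) = r" for x
        using B sub[OF \<open>w \<in> cball z r\<close>] that by (auto simp: dist_norm)
    qed (rule r)
    moreover have "f (Suc 1) w = (deriv ^^ 3) g w"
      by (simp add: f_def eval_nat_numeral)
    ultimately show ?thesis
      by (simp add: fact_numeral)
  qed
  have "cmod (f 0 (z + h) - (\<Sum>i\<le>1. f i z * (z + h - z) ^ i / fact i))
          \<le> 6 * B / r ^ 3 * cmod (z + h - z) ^ Suc 1 / fact 1"
    by (rule complex_Taylor[where S = "cball z r"])
      (use der bound r h in \<open>auto simp: dist_norm\<close>)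
  then have "cmod (deriv g (z + h) - deriv g z - deriv (deriv g) z * h) \<le> 6 * B / r ^ 3 * (cmod h)\<^sup>2"
    by (simp add: f_def algebra_simps power2_eq_square)
  moreover have "(deriv g (z + h) - deriv g z) / h - deriv (deriv g) z =
      (deriv g (z + h) - deriv g z - deriv (deriv g) z * h) / h"
    using h by (simp add: diff_divide_distrib)
  ultimately show ?thesis
    using h by (simp add: norm_divide pos_divide_le_eq power2_eq_square mult.assoc)
qed

text \<open>
  The inner product of the difference quotient \<open>?Q h\<close> of \<open>\<gamma>'\<close> with \<open>y\<close> is within \<open>C \<bar>h\<bar> \<parallel>y\<parallel>\<close> of a number
  independent of \<open>h\<close>.  Comparing \<open>?Q h\<close> and \<open>?Q k\<close> for \<open>y = ?Q h - ?Q k\<close> bounds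
  \<open>\<parallel>?Q h - ?Q k\<parallel>\<^sup>2\<close> by \<open>C (\<bar>h\<bar> + \<bar>k\<bar>) \<parallel>?Q h - ?Q k\<parallel>\<close>, so the quotients satisfy a Cauchy condition in
  norm as \<open>h \<rightarrow> 0\<close> and converge by completeness.
\<close>
lemma right_holomorphic_on_right_deriv:
  fixes \<gamma> :: "complex \<Rightarrow> 'a::quat_hilbert"
  assumes \<gamma>: "right_holomorphic_on \<gamma> D"
  shows "right_holomorphic_on (right_deriv \<gamma>) D"
  unfolding right_holomorphic_on_def
proof (intro conjI ballI)
  show "open D"
    using \<gamma> by (simp add: right_holomorphic_on_def)
  fix z assume "z \<in> D"
  obtain s where s: "0 < s" "cball z s \<subseteq> D"
    using \<open>open D\<close> \<open>z \<in> D\<close> open_contains_cball by blast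
  define r where "r = s / 2"
  have r: "0 < r" "cball z (2 * r) \<subseteq> D"
    using s by (auto simp: r_def)
  have "compact (\<gamma> ` cball z (2 * r))"
    by (rule compact_continuous_image[OF continuous_on_subset[OF
            right_holomorphic_imp_continuous_on[OF \<gamma>] r(2)] compact_cball])
  then have "bounded (\<gamma> ` cball z (2 * r))"
    by (rule compact_imp_bounded)
  then obtain M where M: "\<And>w. w \<in> cball z (2 * r) \<Longrightarrow> norm (\<gamma> w) \<le> M"
    unfolding bounded_iff by blast
  define C where "C = 12 * M / r ^ 3"
  have "z \<in> cball z (2 * r)"
    using r(1) by simp
  then have "0 \<le> M"
    by (rule order_trans[OF norm_ge_zero M])
  then have C_nonneg: "0 \<le> C"
    using r(1) by (simp add: C_def)
  let ?Q = "right_quotient (right_deriv \<gamma>) z"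
  have est: "cmod (cinner (?Q h) y - deriv (deriv (\<lambda>w. cinner (\<gamma> w) y)) z) \<le> C * cmod h * norm y"
    if h: "cmod h \<le> r" "h \<noteq> 0" for h and y :: 'a
  proof -
    interpret bounded_linear "\<lambda>x. cinner x y" by (rule bounded_linear_cinner)
    let ?g = "\<lambda>w. cinner (\<gamma> w) y"
    have "z + h \<in> D"
      using r h by (auto simp: subset_iff dist_norm)
    then have "cinner (?Q h) y = (deriv ?g (z + h) - deriv ?g z) / h"
      using deriv_cinner[OF \<gamma>] \<open>z \<in> D\<close>
      by (simp add: right_quotient_def cinner_scaleQ_complex diff field_class.field_divide_inverse)
    moreover have "cmod ((deriv ?g (z + h) - deriv ?g z) / h - deriv (deriv ?g) z)
        \<le> 6 * (2 * M * norm y) / r ^ 3 * cmod h"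
    proof (rule deriv_quotient_bound)
      show "?g holomorphic_on cball z (2 * r)"
        using cinner_holomorphic_on[OF \<gamma>] r(2) by (rule holomorphic_on_subset)
      show "cmod (?g w) \<le> 2 * M * norm y" if "w \<in> cball z (2 * r)" for w
        using cmod_cinner_le[of "\<gamma> w" y] mult_right_mono[OF M[OF that], of "2 * norm y"]
        by (simp add: mult_ac)
    qed (use r h in auto)
    ultimately show ?thesis
      by (simp add: C_def mult_ac)
  qed
  have cauchy: "norm (?Q h - ?Q k) \<le> C * (cmod h + cmod k)"
    if h: "cmod h \<le> r" "h \<noteq> 0" and k: "cmod k \<le> r" "k \<noteq> 0" for h k
  proof (cases "?Q h = ?Q k")
    case True
    then show ?thesis using C_nonneg by simp
  next
    case False
    let ?y = "?Q h - ?Q k" and ?d = "\<lambda>y. deriv (deriv (\<lambda>w. cinner (\<gamma> w) y)) z"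
    interpret bounded_linear "\<lambda>x. cinner x ?y" by (rule bounded_linear_cinner)
    have "(norm ?y)\<^sup>2 \<le> cmod (cinner (?Q h) ?y - cinner (?Q k) ?y)"
      using norm_sq_le_cinner[of ?y] by (simp add: diff)
    also have "\<dots> \<le> C * cmod h * norm ?y + C * cmod k * norm ?y"
      using norm_triangle_ineq4[of "cinner (?Q h) ?y - ?d ?y" "cinner (?Q k) ?y - ?d ?y"]
        est[OF h, of ?y] est[OF k, of ?y] by simp
    finally have "norm ?y * norm ?y \<le> C * (cmod h + cmod k) * norm ?y"
      by (simp add: algebra_simps power2_eq_square)
    then show ?thesis using False by simp
  qed
  \<comment> \<open>A limit is first found along one null sequence; \<open>cauchy\<close> then gives convergence of the whole
      family to it.\<close>
  define e where "e n = complex_of_real (r / real (Suc n))" for n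
  have e: "cmod (e n) = r / real (Suc n)" for n
    using r by (simp add: e_def norm_divide del: of_nat_Suc)
  have e_le: "cmod (e n) \<le> r" "e n \<noteq> 0" for n
    using r divide_left_mono[of 1 "real (Suc n)" r] by (simp_all add: e, simp add: e_def del: of_nat_Suc)
  have e_lim: "(\<lambda>n. cmod (e n)) \<longlonglongrightarrow> 0"
    unfolding e by (rule LIMSEQ_Suc[OF lim_const_over_n])
  have "Cauchy (\<lambda>n. ?Q (e n))"
  proof (rule CauchyI')
    fix \<epsilon> :: real assume "0 < \<epsilon>"
    moreover have "(\<lambda>n. 2 * C * cmod (e n)) \<longlonglongrightarrow> 0"
      using tendsto_mult[OF tendsto_const e_lim, of "2 * C"] by simp
    ultimately have "\<forall>\<^sub>F n in sequentially. 2 * C * cmod (e n) < \<epsilon>"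
      by (intro order_tendstoD(2))
    then obtain N where N: "\<And>n. N \<le> n \<Longrightarrow> 2 * C * cmod (e n) < \<epsilon>"
      unfolding eventually_sequentially by blast
    have "norm (?Q (e m) - ?Q (e n)) < \<epsilon>" if "N \<le> m" "m < n" for m n
    proof -
      have "cmod (e n) \<le> cmod (e m)"
        unfolding e using r that by (intro divide_left_mono) auto
      then have "C * (cmod (e m) + cmod (e n)) \<le> 2 * C * cmod (e m)"
        using C_nonneg mult_left_mono[of "cmod (e n)" "cmod (e m)" C] by (simp add: algebra_simps)
      with cauchy[OF e_le e_le, of m n] N[OF that(1)] show ?thesis
        by linarith
    qed
    then show "\<exists>M. \<forall>m\<ge>M. \<forall>n>m. dist (?Q (e m)) (?Q (e n)) < \<epsilon>"
      unfolding dist_norm by blast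
  qed
  then obtain d where d: "(\<lambda>n. ?Q (e n)) \<longlonglongrightarrow> d"
    using Cauchy_convergent convergent_def by blast
  have "norm (?Q h - d) \<le> C * cmod h" if h: "cmod h \<le> r" "h \<noteq> 0" for h
  proof (rule LIMSEQ_le)
    show "(\<lambda>n. norm (?Q h - ?Q (e n))) \<longlonglongrightarrow> norm (?Q h - d)"
      by (intro tendsto_intros d)
    show "(\<lambda>n. C * (cmod h + cmod (e n))) \<longlonglongrightarrow> C * cmod h"
      using tendsto_mult[OF tendsto_const[of C] tendsto_add[OF tendsto_const[of "cmod h"] e_lim]]
      by simp
    show "\<exists>N. \<forall>n\<ge>N. norm (?Q h - ?Q (e n)) \<le> C * (cmod h + cmod (e n))"
      using cauchy h e_le by blast
  qed
  then have "\<forall>\<^sub>F h in at 0. norm (?Q h - d) \<le> cmod h * C"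
    unfolding eventually_at using r(1) by (intro exI[of _ r]) (auto simp: dist_norm mult.commute)
  moreover have "((\<lambda>h. h) \<longlongrightarrow> (0::complex)) (at 0)"
    by (rule tendsto_ident_at)
  ultimately have "((\<lambda>h. ?Q h - d) \<longlongrightarrow> 0) (at 0)"
    by (rule_tac tendsto_0_le)
  then show "\<exists>d. (?Q \<longlongrightarrow> d) (at 0)"
    using LIM_zero_iff by blast
qed

lemma right_holomorphic_on_higher_right_deriv:
  "right_holomorphic_on \<gamma> D \<Longrightarrow> right_holomorphic_on ((right_deriv ^^ m) \<gamma>) D"
  by (induction m) (auto intro: right_holomorphic_on_right_deriv)

lemma higher_deriv_cinner:
  assumes "right_holomorphic_on \<gamma> D" "z \<in> D"
  shows "(deriv ^^ m) (\<lambda>w. cinner (\<gamma> w) y) z = cinner ((right_deriv ^^ m) \<gamma> z) y"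
  using assms(2)
proof (induction m arbitrary: z)
  case (Suc m)
  have "open D"
    using assms(1) by (simp add: right_holomorphic_on_def)
  then have "\<forall>\<^sub>F w in nhds z. (deriv ^^ m) (\<lambda>w. cinner (\<gamma> w) y) w = cinner ((right_deriv ^^ m) \<gamma> w) y"
    using Suc eventually_nhds by blast
  then have "(deriv ^^ Suc m) (\<lambda>w. cinner (\<gamma> w) y) z = deriv (\<lambda>w. cinner ((right_deriv ^^ m) \<gamma> w) y) z"
    by (simp add: deriv_cong_ev)
  then show ?case
    by (simp add: deriv_cinner[OF right_holomorphic_on_higher_right_deriv[OF assms(1)] Suc.prems])
qed simp

text \<open>
  The identity theorem for \<open>qinner\<close>, obtained by applying the complex one to its two
  \<open>\<complex>\<close>-components.  The vectors \<open>y\<close> and \<open>y'\<close> may differ because \<open>\<delta>\<close> will be the image of \<open>\<gamma>\<close> under a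
  fibre map and \<open>y'\<close> the image of \<open>y\<close> under another one.
\<close>
lemma right_holomorphic_qinner_eqI:
  assumes \<gamma>: "right_holomorphic_on \<gamma> D" and \<delta>: "right_holomorphic_on \<delta> D"
    and D: "connected D" "z \<in> D" "w \<in> D"
    and eq: "\<And>m. qinner ((right_deriv ^^ m) \<gamma> z) y = qinner ((right_deriv ^^ m) \<delta> z) y'"
  shows "qinner (\<gamma> w) y = qinner (\<delta> w) y'"
proof -
  have "open D"
    using \<gamma> by (simp add: right_holomorphic_on_def)
  have "cinner (\<gamma> w) u = cinner (\<delta> w) u'"
    if "\<And>m. cinner ((right_deriv ^^ m) \<gamma> z) u = cinner ((right_deriv ^^ m) \<delta> z) u'" for u u'
    by (rule holomorphic_fun_eq_on_connected[OF cinner_holomorphic_on[OF \<gamma>]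
          cinner_holomorphic_on[OF \<delta>] \<open>open D\<close>])
      (use that D in \<open>simp_all add: higher_deriv_cinner[OF \<gamma>] higher_deriv_cinner[OF \<delta>]\<close>)
  with eq show ?thesis
    unfolding qinner_eq_iff_cinner by blast
qed

lemma higher_right_deriv_qinner_cong_ev:
  assumes \<gamma>: "right_holomorphic_on \<gamma> D" and \<delta>: "right_holomorphic_on \<delta> D" and "z \<in> D"
    and ev: "\<forall>\<^sub>F w in nhds z. qinner (\<gamma> w) y = qinner (\<delta> w) y'"
  shows "qinner ((right_deriv ^^ m) \<gamma> z) y = qinner ((right_deriv ^^ m) \<delta> z) y'"
proof -
  have "cinner ((right_deriv ^^ m) \<gamma> z) u = cinner ((right_deriv ^^ m) \<delta> z) u'"
    if "\<forall>\<^sub>F w in nhds z. cinner (\<gamma> w) u = cinner (\<delta> w) u'" for u u'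
    using higher_deriv_cong_ev[OF that refl, of m]
    by (simp add: higher_deriv_cinner[OF \<gamma> \<open>z \<in> D\<close>] higher_deriv_cinner[OF \<delta> \<open>z \<in> D\<close>])
  with ev show ?thesis
    unfolding qinner_eq_iff_cinner eventually_conj_iff by blast
qed

text \<open>
  The hypothesis asks for \<open>\<delta> = U \<circ> \<gamma>\<close> on \<open>D\<close> only, so that the lemma can be iterated: the \<open>m\<close>-th
  derivatives of \<open>U \<circ> \<gamma>\<close> and of \<open>\<gamma>\<close> are related by \<open>U\<close> on \<open>D\<close>, but in general not outside.
\<close>
lemma right_quotient_bounded_qlinear_tendsto:
  assumes U: "bounded_qlinear U" and \<gamma>: "right_holomorphic_on \<gamma> D"
    and eq: "\<And>w. w \<in> D \<Longrightarrow> \<delta> w = U (\<gamma> w)" and "z \<in> D"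
  shows "(right_quotient \<delta> z \<longlongrightarrow> U (right_deriv \<gamma> z)) (at 0)"
proof -
  interpret bounded_linear U
    using U by (simp add: bounded_qlinear_def)
  have "open ((\<lambda>h. z + h) -` D)" and "0 \<in> (\<lambda>h. z + h) -` D"
    using \<gamma> \<open>z \<in> D\<close> by (auto simp: right_holomorphic_on_def intro!: continuous_open_vimage continuous_intros)
  then have "\<forall>\<^sub>F h in nhds 0. z + h \<in> D"
    unfolding eventually_nhds by blast
  then have "\<forall>\<^sub>F h in at 0. z + h \<in> D"
    by (simp add: eventually_at_filter eventually_mono)
  then have "\<forall>\<^sub>F h in at 0. right_quotient \<delta> z h = U (right_quotient \<gamma> z h)"
    by eventually_elim
      (use U \<open>z \<in> D\<close> in \<open>simp add: right_quotient_def eq diff bounded_qlinear_def\<close>)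
  with tendsto[OF right_quotient_tendsto_right_deriv[OF \<gamma> \<open>z \<in> D\<close>]] show ?thesis
    using tendsto_cong by fastforce
qed

lemma right_holomorphic_on_bounded_qlinear:
  assumes "bounded_qlinear U" "right_holomorphic_on \<gamma> D"
  shows "right_holomorphic_on (\<lambda>w. U (\<gamma> w)) D"
  using assms right_quotient_bounded_qlinear_tendsto[OF assms, of "\<lambda>w. U (\<gamma> w)"]
  unfolding right_holomorphic_on_def by blast

lemma higher_right_deriv_bounded_qlinear:
  assumes "bounded_qlinear U" "right_holomorphic_on \<gamma> D" "z \<in> D"
  shows "(right_deriv ^^ m) (\<lambda>w. U (\<gamma> w)) z = U ((right_deriv ^^ m) \<gamma> z)"
  using assms(3)
proof (induction m arbitrary: z)
  case (Suc m)
  have "(right_quotient ((right_deriv ^^ m) (\<lambda>w. U (\<gamma> w))) z \<longlongrightarrow>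
      U (right_deriv ((right_deriv ^^ m) \<gamma>) z)) (at 0)"
    by (rule right_quotient_bounded_qlinear_tendsto[where D = D])
      (use assms Suc right_holomorphic_on_higher_right_deriv in auto)
  then show ?case
    unfolding right_deriv_def[of "(right_deriv ^^ m) (\<lambda>w. U (\<gamma> w))"] funpow.simps comp_apply
    by (intro tendsto_Lim) auto
qed simp

section \<open>Extending isometric relations to unitary operators\<close>

lemma qspan_superset: "B \<subseteq> qspan B"
proof
  fix b assume "b \<in> B"
  then show "b \<in> qspan B"
    unfolding qspan_def
    by (auto intro!: exI[of _ "{b}"] exI[of _ "\<lambda>_. 1"] simp: scaleQ_one)
qed

lemma qspan_minimal:
  assumes "B \<subseteq> S" "qsubspace S"
  shows "qspan B \<subseteq> S"
proof -
  have "(\<Sum>b\<in>F. b *\<^sub>Q c b) \<in> S" if "finite F" "F \<subseteq> B" for F c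
    using that by (induction F) (use assms in \<open>auto simp: qsubspace_def\<close>)
  then show ?thesis
    by (auto simp: qspan_def)
qed

text \<open>
  The right \<open>\<H>\<close>-linear span of \<open>G\<close> inside the product space.  Working with the span as a relation
  postpones the question whether the linear extension of \<open>G\<close> is well defined: it follows at the end
  from preservation of the norm.
\<close>
inductive graph_span :: "('a \<times> 'a) set \<Rightarrow> 'a::right_quat_vector \<Rightarrow> 'a \<Rightarrow> bool"
  for G :: "('a \<times> 'a) set" where
  zero: "graph_span G 0 0"
| step: "graph_span G x y \<Longrightarrow> (u, v) \<in> G \<Longrightarrow> graph_span G (x + u *\<^sub>Q q) (y + v *\<^sub>Q q)"

lemma graph_span_base: "(u, v) \<in> G \<Longrightarrow> graph_span G u v"
  using graph_span.step[OF graph_span.zero, of u v G 1] by (simp add: scaleQ_one)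

lemma graph_span_add:
  "graph_span G x y \<Longrightarrow> graph_span G x' y' \<Longrightarrow> graph_span G (x + x') (y + y')"
  by (induction rule: graph_span.induct)
    (auto simp: add_ac dest: graph_span.step)

lemma graph_span_scaleQ: "graph_span G x y \<Longrightarrow> graph_span G (x *\<^sub>Q q) (y *\<^sub>Q q)"
  by (induction rule: graph_span.induct)
    (auto simp: scaleQ_add_left scaleQ_scaleQ intro: graph_span.intros)

lemma graph_span_diff:
  "graph_span G x y \<Longrightarrow> graph_span G x' y' \<Longrightarrow> graph_span G (x - x') (y - y')"
  using graph_span_add[OF _ graph_span_scaleQ[of G x' y' "- 1"], of x y]
  by (simp add: scaleQ_minus_one)

lemma graph_span_converse: "graph_span G x y \<Longrightarrow> graph_span (G\<inverse>) y x"
  by (induction rule: graph_span.induct) (auto intro: graph_span.intros)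

lemma graph_span_total:
  assumes "x \<in> qspan (fst ` G)"
  shows "\<exists>y. graph_span G x y"
proof -
  have "qspan (fst ` G) \<subseteq> {x. \<exists>y. graph_span G x y}"
  proof (rule qspan_minimal)
    show "fst ` G \<subseteq> {x. \<exists>y. graph_span G x y}"
      using graph_span_base by fastforce
    show "qsubspace {x. \<exists>y. graph_span G x y}"
      unfolding qsubspace_def
      using graph_span.zero graph_span_add graph_span_scaleQ by blast
  qed
  with assms show ?thesis by blast
qed

definition isometric_relation :: "('a::quat_hilbert \<times> 'a) set \<Rightarrow> bool" where
  "isometric_relation G \<longleftrightarrow> (\<forall>(x, y)\<in>G. \<forall>(x', y')\<in>G. qinner x x' = qinner y y')"

lemma isometric_relation_converse: "isometric_relation G \<Longrightarrow> isometric_relation (G\<inverse>)"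
  by (fastforce simp: isometric_relation_def)

lemma graph_span_qinner:
  assumes G: "isometric_relation G" and "graph_span G x y" "graph_span G x' y'"
  shows "qinner x x' = qinner y y'"
  using assms(2)
proof induction
  case (step x y u v q)
  have "qinner u x' = qinner v y'"
    using assms(3)
  proof induction
    case (step x y u' v' q)
    then have "qinner u u' = qinner v v'"
      using G \<open>(u, v) \<in> G\<close> by (fastforce simp: isometric_relation_def)
    with step show ?case
      by (simp add: qinner_add_right qinner_scaleQ_right)
  qed simp
  with step show ?case
    by (simp add: qinner_add_left qinner_scaleQ_left)
qed simp

lemma graph_span_norm:
  "isometric_relation G \<Longrightarrow> graph_span G x y \<Longrightarrow> norm x = norm y"
  by (simp add: norm_eq_sqrt_qinner graph_span_qinner)

definition closed_graph_span :: "('a::quat_hilbert \<times> 'a) set \<Rightarrow> 'a \<Rightarrow> 'a \<Rightarrow> bool" where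
  "closed_graph_span G x y \<longleftrightarrow>
     (\<exists>s t. (\<forall>n. graph_span G (s n) (t n)) \<and> s \<longlonglongrightarrow> x \<and> t \<longlonglongrightarrow> y)"

lemma closed_graph_span_base: "(u, v) \<in> G \<Longrightarrow> closed_graph_span G u v"
  unfolding closed_graph_span_def
  by (intro exI[of _ "\<lambda>_. u"] exI[of _ "\<lambda>_. v"]) (simp add: graph_span_base)

lemma closed_graph_span_add:
  assumes "closed_graph_span G x y" "closed_graph_span G x' y'"
  shows "closed_graph_span G (x + x') (y + y')"
proof -
  obtain s t s' t' where "\<And>n. graph_span G (s n) (t n)" "s \<longlonglongrightarrow> x" "t \<longlonglongrightarrow> y"
      "\<And>n. graph_span G (s' n) (t' n)" "s' \<longlonglongrightarrow> x'" "t' \<longlonglongrightarrow> y'"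
    using assms unfolding closed_graph_span_def by blast
  then show ?thesis
    unfolding closed_graph_span_def
    by (intro exI[of _ "\<lambda>n. s n + s' n"] exI[of _ "\<lambda>n. t n + t' n"])
      (auto intro: graph_span_add tendsto_add)
qed

lemma closed_graph_span_scaleQ:
  assumes "closed_graph_span G x y"
  shows "closed_graph_span G (x *\<^sub>Q q) (y *\<^sub>Q q)"
proof -
  obtain s t where "\<And>n. graph_span G (s n) (t n)" "s \<longlonglongrightarrow> x" "t \<longlonglongrightarrow> y"
    using assms unfolding closed_graph_span_def by blast
  then show ?thesis
    unfolding closed_graph_span_def
    by (intro exI[of _ "\<lambda>n. s n *\<^sub>Q q"] exI[of _ "\<lambda>n. t n *\<^sub>Q q"])
      (auto intro: graph_span_scaleQ bounded_linear.tendsto[OF bounded_linear_scaleQ])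
qed

lemma closed_graph_span_diff:
  "closed_graph_span G x y \<Longrightarrow> closed_graph_span G x' y' \<Longrightarrow> closed_graph_span G (x - x') (y - y')"
  using closed_graph_span_add[OF _ closed_graph_span_scaleQ[of G x' y' "- 1"], of x y]
  by (simp add: scaleQ_minus_one)

lemma closed_graph_span_converse: "closed_graph_span G x y \<Longrightarrow> closed_graph_span (G\<inverse>) y x"
  unfolding closed_graph_span_def using graph_span_converse by blast

lemma closed_graph_span_norm:
  assumes G: "isometric_relation G" and "closed_graph_span G x y"
  shows "norm x = norm y"
proof -
  obtain s t where st: "\<And>n. graph_span G (s n) (t n)" "s \<longlonglongrightarrow> x" "t \<longlonglongrightarrow> y"
    using assms unfolding closed_graph_span_def by blast
  have "(\<lambda>n. norm (s n)) = (\<lambda>n. norm (t n))"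
    using graph_span_norm[OF G st(1)] by simp
  then show ?thesis
    using tendsto_norm[OF st(2)] tendsto_norm[OF st(3)] LIMSEQ_unique by metis
qed

text \<open>
  Preservation of norms passes to limits, and norms determine the real part of \<open>qinner\<close> by
  polarization.  Since the relation is closed under right multiplication, the real parts of
  \<open>qinner x x' * q\<close> agree for all \<open>q\<close>; the units \<open>1, i, j, k\<close> then give all four components.
\<close>
lemma closed_graph_span_qinner:
  assumes G: "isometric_relation G"
    and xy: "closed_graph_span G x y" "closed_graph_span G x' y'"
  shows "qinner x x' = qinner y y'"
proof -
  have re: "qRe (qinner u x') = qRe (qinner v y')" if "closed_graph_span G u v" for u v
    using qRe_qinner_polarization[of u x'] qRe_qinner_polarization[of v y']
      closed_graph_span_norm[OF G that] closed_graph_span_norm[OF G xy(2)]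
      closed_graph_span_norm[OF G closed_graph_span_add[OF that xy(2)]] by simp
  have "qRe (qinner x x' * q) = qRe (qinner y y' * q)" for q
    using re[OF closed_graph_span_scaleQ[OF xy(1), of q]] by (simp add: qinner_scaleQ_left)
  from this[of "1"] this[of "Quat 0 1 0 0"] this[of "Quat 0 0 1 0"] this[of "Quat 0 0 0 1"]
  show ?thesis
    by (simp add: quat_simps quat.expand)
qed

text \<open>
  An approximating sequence \<open>s\<close> in the dense span is Cauchy, hence so is a sequence \<open>t\<close> of partners,
  which has the same mutual distances.
\<close>
lemma closed_graph_span_total:
  assumes G: "isometric_relation G" and "closure (qspan (fst ` G)) = UNIV"
  shows "\<exists>y. closed_graph_span G x y"
proof -
  have "x \<in> closure (qspan (fst ` G))"
    using assms(2) by simp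
  then obtain s where s: "\<And>n. s n \<in> qspan (fst ` G)" "s \<longlonglongrightarrow> x"
    unfolding closure_sequential by blast
  obtain t where t: "\<And>n. graph_span G (s n) (t n)"
    using graph_span_total[OF s(1)] by metis
  have "dist (t m) (t n) = dist (s m) (s n)" for m n
    using graph_span_norm[OF G graph_span_diff[OF t t], of m n] by (simp add: dist_norm)
  moreover have "Cauchy s"
    using s(2) by (rule LIMSEQ_imp_Cauchy)
  ultimately have "Cauchy t"
    by (simp add: Cauchy_def)
  then show ?thesis
    using s(2) t unfolding closed_graph_span_def
    using Cauchy_convergent convergent_def by metis
qed

text \<open>
  The closed span of \<open>G\<close> is a linear isometric relation, total by density of the domain and surjective
  by density of the range.  A linear relation that preserves norms is single-valued in both
  directions, so it is the graph of a unitary operator, whose adjoint is the inverse relation.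
\<close>
lemma isometric_relation_extends_to_qunitary:
  fixes G :: "('a::quat_hilbert \<times> 'a) set"
  assumes G: "isometric_relation G"
    and dense: "closure (qspan (fst ` G)) = UNIV" "closure (qspan (snd ` G)) = UNIV"
  obtains U where "qunitary U" "\<And>x y. (x, y) \<in> G \<Longrightarrow> U x = y"
proof -
  let ?R = "closed_graph_span G"
  have "fst ` (G\<inverse>) = snd ` G"
    by force
  then have "\<exists>x. closed_graph_span (G\<inverse>) y x" for y
    using closed_graph_span_total[OF isometric_relation_converse[OF G]] dense(2) by simp
  then have "\<exists>x. ?R x y" for y
    using closed_graph_span_converse by fastforce
  then obtain V where V: "\<And>y. ?R (V y) y"
    by metis
  obtain U where U: "\<And>x. ?R x (U x)"
    using closed_graph_span_total[OF G dense(1)] by metis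
  have right_unique: "y = y'" if "?R x y" "?R x y'" for x y y'
    using closed_graph_span_norm[OF G closed_graph_span_diff[OF that]] by simp
  have left_unique: "x = x'" if "?R x y" "?R x' y" for x x' y
    using closed_graph_span_norm[OF G closed_graph_span_diff[OF that]] by simp
  have bounded: "bounded_qlinear W"
    if add: "\<And>x y. W (x + y) = W x + W y" and scale: "\<And>x q. W (x *\<^sub>Q q) = W x *\<^sub>Q q"
      and norm: "\<And>x. norm (W x) = norm x" for W :: "'a \<Rightarrow> 'a"
    unfolding bounded_qlinear_def
    by (auto intro!: bounded_linear_intro[where K = 1] simp: add scale norm scaleR_eq_scaleQ)
  have "bounded_qlinear U"
    by (rule bounded)
      (use right_unique U closed_graph_span_add closed_graph_span_scaleQ
        closed_graph_span_norm[OF G] in \<open>metis\<close>)+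
  moreover have "bounded_qlinear V"
    by (rule bounded)
      (use left_unique V closed_graph_span_add closed_graph_span_scaleQ
        closed_graph_span_norm[OF G] in \<open>metis\<close>)+
  moreover have "is_qadjoint U V"
    unfolding is_qadjoint_def using closed_graph_span_qinner[OF G U V] by simp
  moreover have "V \<circ> U = id" "U \<circ> V = id"
    using left_unique[OF V U] right_unique[OF U V] by (simp_all add: fun_eq_iff)
  ultimately have "qunitary U"
    unfolding qunitary_def by blast
  moreover have "U x = y" if "(x, y) \<in> G" for x y
    using right_unique[OF U closed_graph_span_base[OF that]] .
  ultimately show thesis
    by (rule that)
qed

section \<open>Congruence of curves and equivalence of bundles\<close>

text \<open>
  Whether a fibre map preserves the inner product with a fixed vector can be tested on a spanning set
  of the fibre.
\<close>
lemma qlinear_iso_on_qinner_eqI: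
  assumes S: "qsubspace S" and f: "qlinear_iso_on f S T" and B: "B \<subseteq> S"
    and eq: "\<And>b. b \<in> B \<Longrightarrow> qinner b y = qinner (f b) y'" and x: "x \<in> qspan B"
  shows "qinner x y = qinner (f x) y'"
proof -
  have "f 0 = f (0 *\<^sub>Q 0)"
    by simp
  also have "\<dots> = f 0 *\<^sub>Q 0"
    using f S unfolding qlinear_iso_on_def qsubspace_def by blast
  finally have "f 0 = 0"
    by simp
  then have "qsubspace {x \<in> S. qinner x y = qinner (f x) y'}"
    using f S by (auto simp: qsubspace_def qlinear_iso_on_def qinner_add_left qinner_scaleQ_left)
  then have "qspan B \<subseteq> {x \<in> S. qinner x y = qinner (f x) y'}"
    using B eq by (intro qspan_minimal) auto
  with x show ?thesis by blast
qed

lemma right_holomorphic_curve_frame: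
  assumes "right_holomorphic_curve n \<Delta> t" "\<omega> \<in> \<Delta>"
  shows "\<exists>r \<gamma>. 0 < r \<and> ball \<omega> r \<subseteq> \<Delta> \<and>
    (\<forall>i<n. cross_section \<Delta> t (ball \<omega> r) (\<gamma> i)) \<and>
    (\<forall>w\<in>ball \<omega> r. qspan ((\<lambda>i. \<gamma> i w) ` {..<n}) = t w)"
proof -
  have "\<exists>D \<gamma>. open D \<and> \<omega> \<in> D \<and> D \<subseteq> \<Delta> \<and> (\<forall>i<n. right_holomorphic_on (\<gamma> i) D) \<and>
      (\<forall>w\<in>D. qbasis n (\<lambda>i. \<gamma> i w) (t w))"
    using assms by (simp add: right_holomorphic_curve_def)
  then obtain D \<gamma> where D: "open D" "\<omega> \<in> D" "D \<subseteq> \<Delta>"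
    and hol: "\<forall>i<n. right_holomorphic_on (\<gamma> i) D"
    and basis: "\<forall>w\<in>D. qbasis n (\<lambda>i. \<gamma> i w) (t w)"
    by blast
  obtain r where r: "0 < r" "ball \<omega> r \<subseteq> D"
    using D(1,2) open_contains_ball by blast
  have span: "\<forall>w\<in>ball \<omega> r. qspan ((\<lambda>i. \<gamma> i w) ` {..<n}) = t w"
    using basis r(2) by (auto simp: qbasis_def)
  have mem: "\<gamma> i w \<in> t w" if "i < n" "w \<in> ball \<omega> r" for i w
    using qspan_superset[of "(\<lambda>i. \<gamma> i w) ` {..<n}"] bspec[OF span that(2)] that(1) by auto
  have "cross_section \<Delta> t (ball \<omega> r) (\<gamma> i)" if "i < n" for i
    unfolding cross_section_def
    using right_holomorphic_on_subset[OF hol[rule_format, OF that] open_ball r(2)] r(2) D(3)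
      mem[OF that]
    by blast
  with r D(3) span show ?thesis
    by (intro exI[of _ r] exI[of _ \<gamma>]) auto
qed

lemma right_holomorphic_curve_qsubspace:
  "right_holomorphic_curve n \<Delta> t \<Longrightarrow> \<omega> \<in> \<Delta> \<Longrightarrow> qsubspace (t \<omega>)"
  by (auto simp: right_holomorphic_curve_def grassmannian_def)

text \<open>
  The step from one fibre to two distant ones.  For fixed \<open>y\<close> in the fibre over \<open>\<omega>'\<close>, \<open>agree w\<close> says that
  the inner products of the fibre over \<open>w\<close> with \<open>y\<close> are preserved.  The property propagated along
  \<open>\<Delta>\<close> is agreement \<^emph>\<open>near\<close> a point: agreement at a single point would give the identity theorem nothing
  to start from.
\<close>
lemma fibre_maps_preserve_qinner:
  fixes t\<^sub>1 t\<^sub>2 :: "complex \<Rightarrow> 'a::quat_hilbert set"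
  assumes \<Delta>: "open \<Delta>" "connected \<Delta>"
    and t\<^sub>1: "right_holomorphic_curve n \<Delta> t\<^sub>1"
    and iso: "\<And>\<omega>. \<omega> \<in> \<Delta> \<Longrightarrow> qlinear_iso_on (fibre_map \<Phi> \<omega>) (t\<^sub>1 \<omega>) (t\<^sub>2 \<omega>)"
    and sec: "\<And>D \<gamma>. cross_section \<Delta> t\<^sub>1 D \<gamma> \<Longrightarrow> cross_section \<Delta> t\<^sub>2 D (map_section \<Phi> \<gamma>)"
    and deriv: "\<And>D \<gamma> \<eta> m \<omega>. cross_section \<Delta> t\<^sub>1 D \<gamma> \<Longrightarrow> cross_section \<Delta> t\<^sub>1 D \<eta> \<Longrightarrow> \<omega> \<in> D \<Longrightarrow>
        qinner ((right_deriv ^^ m) \<gamma> \<omega>) (\<eta> \<omega>) =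
        qinner ((right_deriv ^^ m) (map_section \<Phi> \<gamma>) \<omega>) (map_section \<Phi> \<eta> \<omega>)"
    and pts: "\<omega> \<in> \<Delta>" "x \<in> t\<^sub>1 \<omega>" "\<omega>' \<in> \<Delta>" "y \<in> t\<^sub>1 \<omega>'"
  shows "qinner x y = qinner (fibre_map \<Phi> \<omega> x) (fibre_map \<Phi> \<omega>' y)"
proof -
  let ?y' = "fibre_map \<Phi> \<omega>' y"
  define agree where
    "agree w \<longleftrightarrow> (\<forall>x\<in>t\<^sub>1 w. qinner x y = qinner (fibre_map \<Phi> w x) ?y')" for w
  note sub = right_holomorphic_curve_qsubspace[OF t\<^sub>1]
  have hol: "right_holomorphic_on \<gamma> D" "right_holomorphic_on (map_section \<Phi> \<gamma>) D"
    if "cross_section \<Delta> t\<^sub>1 D \<gamma>" for \<gamma> D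
    using that sec[OF that] by (simp_all add: cross_section_def)
  have agreeI: "agree w"
    if w: "w \<in> \<Delta>" and span: "qspan ((\<lambda>i. \<gamma> i w) ` {..<n}) = t\<^sub>1 w"
      and frame: "\<And>i. i < n \<Longrightarrow> qinner (\<gamma> i w) y = qinner (map_section \<Phi> (\<gamma> i) w) ?y'" for w \<gamma>
    unfolding agree_def
  proof
    fix x assume "x \<in> t\<^sub>1 w"
    show "qinner x y = qinner (fibre_map \<Phi> w x) ?y'"
    proof (rule qlinear_iso_on_qinner_eqI[OF sub[OF w] iso[OF w]])
      show "(\<lambda>i. \<gamma> i w) ` {..<n} \<subseteq> t\<^sub>1 w"
        using qspan_superset[of "(\<lambda>i. \<gamma> i w) ` {..<n}"] span by simp
      show "qinner b y = qinner (fibre_map \<Phi> w b) ?y'" if b: "b \<in> (\<lambda>i. \<gamma> i w) ` {..<n}" for b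
        using b frame by (auto simp: map_section_def)
      show "x \<in> qspan ((\<lambda>i. \<gamma> i w) ` {..<n})"
        using \<open>x \<in> t\<^sub>1 w\<close> span by simp
    qed
  qed
  have agreeD: "qinner (\<gamma> w) y = qinner (map_section \<Phi> \<gamma> w) ?y'"
    if "agree w" "cross_section \<Delta> t\<^sub>1 D \<gamma>" "w \<in> D" for w \<gamma> D
    using that by (auto simp: agree_def cross_section_def map_section_def)
  have ev_ball: "\<forall>\<^sub>F v in nhds w. agree v" if "\<And>v. v \<in> ball a r \<Longrightarrow> agree v" "w \<in> ball a r" for a r w
    unfolding eventually_nhds using that by (intro exI[of _ "ball a r"]) auto
  have start: "\<forall>\<^sub>F w in nhds \<omega>'. agree w"
  proof -
    obtain r \<gamma> where r: "0 < r" "ball \<omega>' r \<subseteq> \<Delta>"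
      and cs: "\<And>i. i < n \<Longrightarrow> cross_section \<Delta> t\<^sub>1 (ball \<omega>' r) (\<gamma> i)"
      and span: "\<And>w. w \<in> ball \<omega>' r \<Longrightarrow> qspan ((\<lambda>i. \<gamma> i w) ` {..<n}) = t\<^sub>1 w"
      using right_holomorphic_curve_frame[OF t\<^sub>1 \<open>\<omega>' \<in> \<Delta>\<close>] by blast
    let ?B = "(\<lambda>i. \<gamma> i \<omega>') ` {..<n}"
    have B: "?B \<subseteq> t\<^sub>1 \<omega>'" "y \<in> qspan ?B"
      using span[of \<omega>'] qspan_superset[of ?B] r \<open>y \<in> t\<^sub>1 \<omega>'\<close> by auto
    \<comment> \<open>The derivative condition holds for \<open>y\<close> in the frame at \<open>\<omega>'\<close>, hence for its span, which is the
        whole fibre.\<close>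
    have deriv_eq: "qinner ((right_deriv ^^ m) (\<gamma> i) \<omega>') y =
        qinner ((right_deriv ^^ m) (map_section \<Phi> (\<gamma> i)) \<omega>') ?y'" if i: "i < n" for i m
    proof -
      have "qinner y ((right_deriv ^^ m) (\<gamma> i) \<omega>') =
        qinner ?y' ((right_deriv ^^ m) (map_section \<Phi> (\<gamma> i)) \<omega>')"
      proof (rule qlinear_iso_on_qinner_eqI[OF sub iso B(1) _ B(2)])
        fix b assume "b \<in> ?B"
        then obtain j where j: "j < n" "b = \<gamma> j \<omega>'" by auto
        show "qinner b ((right_deriv ^^ m) (\<gamma> i) \<omega>') =
          qinner (fibre_map \<Phi> \<omega>' b) ((right_deriv ^^ m) (map_section \<Phi> (\<gamma> i)) \<omega>')"
          using deriv[OF cs[OF i] cs[OF j(1)], of \<omega>' m] r qinner_commute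
          by (metis centre_in_ball j(2) map_section_def)
      qed (use \<open>\<omega>' \<in> \<Delta>\<close> in auto)
      then show ?thesis
        by (metis qinner_commute)
    qed
    have "agree w" if w: "w \<in> ball \<omega>' r" for w
    proof (rule agreeI[of w \<gamma>, OF _ span[OF w]])
      show "qinner (\<gamma> i w) y = qinner (map_section \<Phi> (\<gamma> i) w) ?y'" if i: "i < n" for i
        by (rule right_holomorphic_qinner_eqI[OF hol[OF cs[OF i]] connected_ball _ w deriv_eq[OF i]])
          (use r(1) in simp)
    qed (use r(2) w in blast)
    then show ?thesis
      by (rule ev_ball) (use r(1) in auto)
  qed
  have "\<forall>\<^sub>F w in nhds \<omega>. agree w"
  proof (rule connected_induction_simple[where P = "\<lambda>z. \<forall>\<^sub>F w in nhds z. agree w",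
        OF \<Delta>(2) \<open>\<omega>' \<in> \<Delta>\<close> \<open>\<omega> \<in> \<Delta>\<close> start])
    fix a assume "a \<in> \<Delta>"
    obtain r \<gamma> where r: "0 < r" "ball a r \<subseteq> \<Delta>"
      and cs: "\<And>i. i < n \<Longrightarrow> cross_section \<Delta> t\<^sub>1 (ball a r) (\<gamma> i)"
      and span: "\<And>w. w \<in> ball a r \<Longrightarrow> qspan ((\<lambda>i. \<gamma> i w) ` {..<n}) = t\<^sub>1 w"
      using right_holomorphic_curve_frame[OF t\<^sub>1 \<open>a \<in> \<Delta>\<close>] by blast
    have "agree v" if z: "z \<in> ball a r" "\<forall>\<^sub>F w in nhds z. agree w" and v: "v \<in> ball a r" for z v
    proof (rule agreeI[of v \<gamma>, OF _ span[OF v]])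
      fix i assume i: "i < n"
      have "\<forall>\<^sub>F w in nhds z. w \<in> ball a r"
        using z(1) eventually_nhds by blast
      with z(2) have "\<forall>\<^sub>F w in nhds z. qinner (\<gamma> i w) y = qinner (map_section \<Phi> (\<gamma> i) w) ?y'"
        by eventually_elim (rule agreeD[OF _ cs[OF i]])
      then show "qinner (\<gamma> i v) y = qinner (map_section \<Phi> (\<gamma> i) v) ?y'"
        by (intro right_holomorphic_qinner_eqI[OF hol[OF cs[OF i]] connected_ball z(1) v]
            higher_right_deriv_qinner_cong_ev[OF hol[OF cs[OF i]] z(1)])
    qed (use r v in auto)
    then have "\<forall>z\<in>ball a r. \<forall>w\<in>ball a r.
        (\<forall>\<^sub>F v in nhds z. agree v) \<longrightarrow> (\<forall>\<^sub>F v in nhds w. agree v)"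
      using ev_ball by blast
    moreover have "openin (top_of_set \<Delta>) (ball a r)" "a \<in> ball a r"
      using r \<Delta>(1) by (auto simp: openin_open_eq)
    ultimately show "\<exists>T. openin (top_of_set \<Delta>) T \<and> a \<in> T \<and>
        (\<forall>z\<in>T. \<forall>w\<in>T. (\<forall>\<^sub>F v in nhds z. agree v) \<longrightarrow> (\<forall>\<^sub>F v in nhds w. agree v))"
      by blast
  qed
  then have "agree \<omega>"
    by (rule eventually_nhds_x_imp_x)
  with \<open>x \<in> t\<^sub>1 \<omega>\<close> show ?thesis
    by (simp add: agree_def)
qed

lemma equivalent_imp_congruent:
  fixes t\<^sub>1 t\<^sub>2 :: "complex \<Rightarrow> 'a::quat_hilbert set"
  assumes \<Delta>: "open \<Delta>" "connected \<Delta>"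
    and t\<^sub>1: "right_holomorphic_curve n \<Delta> t\<^sub>1"
    and dense: "closure (qspan (\<Union>\<omega>\<in>\<Delta>. t\<^sub>1 \<omega>)) = UNIV" "closure (qspan (\<Union>\<omega>\<in>\<Delta>. t\<^sub>2 \<omega>)) = UNIV"
    and eq: "equivalent_bundles \<Delta> t\<^sub>1 t\<^sub>2"
  shows "congruent_curves \<Delta> t\<^sub>1 t\<^sub>2"
proof -
  obtain \<Phi> where iso: "\<And>\<omega>. \<omega> \<in> \<Delta> \<Longrightarrow> qlinear_iso_on (fibre_map \<Phi> \<omega>) (t\<^sub>1 \<omega>) (t\<^sub>2 \<omega>)"
    and sec: "\<And>D \<gamma>. cross_section \<Delta> t\<^sub>1 D \<gamma> \<Longrightarrow> cross_section \<Delta> t\<^sub>2 D (map_section \<Phi> \<gamma>)"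
    and deriv: "\<And>D \<gamma> \<eta> m \<omega>. cross_section \<Delta> t\<^sub>1 D \<gamma> \<Longrightarrow> cross_section \<Delta> t\<^sub>1 D \<eta> \<Longrightarrow> \<omega> \<in> D \<Longrightarrow>
        qinner ((right_deriv ^^ m) \<gamma> \<omega>) (\<eta> \<omega>) =
        qinner ((right_deriv ^^ m) (map_section \<Phi> \<gamma>) \<omega>) (map_section \<Phi> \<eta> \<omega>)"
    using eq unfolding equivalent_bundles_def by metis
  define G where "G = {(x, fibre_map \<Phi> \<omega> x) | x \<omega>. \<omega> \<in> \<Delta> \<and> x \<in> t\<^sub>1 \<omega>}"
  have image: "fibre_map \<Phi> \<omega> ` t\<^sub>1 \<omega> = t\<^sub>2 \<omega>" if "\<omega> \<in> \<Delta>" for \<omega>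
    using iso[OF that] by (simp add: qlinear_iso_on_def bij_betw_def)
  have "isometric_relation G"
    unfolding isometric_relation_def G_def
    using fibre_maps_preserve_qinner[OF \<Delta> t\<^sub>1 iso sec deriv] by auto
  moreover have "fst ` G = (\<Union>\<omega>\<in>\<Delta>. t\<^sub>1 \<omega>)"
    by (force simp: G_def)
  moreover have "snd ` G = (\<Union>\<omega>\<in>\<Delta>. fibre_map \<Phi> \<omega> ` t\<^sub>1 \<omega>)"
    by (force simp: G_def)
  moreover have "\<dots> = (\<Union>\<omega>\<in>\<Delta>. t\<^sub>2 \<omega>)"
    using image by simp
  ultimately obtain U where U: "qunitary U" "\<And>x y. (x, y) \<in> G \<Longrightarrow> U x = y"
    using isometric_relation_extends_to_qunitary[of G] dense by metis
  have "t\<^sub>2 \<omega> = U ` t\<^sub>1 \<omega>" if "\<omega> \<in> \<Delta>" for \<omega>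
  proof -
    have "U ` t\<^sub>1 \<omega> = fibre_map \<Phi> \<omega> ` t\<^sub>1 \<omega>"
      by (rule image_cong) (use U(2) that in \<open>auto simp: G_def\<close>)
    with image[OF that] show ?thesis by simp
  qed
  with U(1) show ?thesis
    unfolding congruent_curves_def by blast
qed

lemma congruent_imp_equivalent:
  assumes "congruent_curves \<Delta> t\<^sub>1 t\<^sub>2"
  shows "equivalent_bundles \<Delta> t\<^sub>1 t\<^sub>2"
proof -
  obtain U where U: "qunitary U" and t\<^sub>2: "\<And>\<omega>. \<omega> \<in> \<Delta> \<Longrightarrow> t\<^sub>2 \<omega> = U ` t\<^sub>1 \<omega>"
    using assms unfolding congruent_curves_def by blast
  then obtain V where lin: "bounded_qlinear U" and adj: "is_qadjoint U V" and inv: "V \<circ> U = id"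
    unfolding qunitary_def by blast
  have VU: "V (U x) = x" for x
    using inv by (metis comp_apply id_apply)
  have U_qinner: "qinner (U x) (U y) = qinner x y" for x y
    using adj VU by (simp add: is_qadjoint_def)
  interpret bounded_linear U
    using lin by (simp add: bounded_qlinear_def)
  define \<Phi> where "\<Phi> p = (U (fst p), snd p)" for p :: "'a \<times> complex"
  have fibre: "fibre_map \<Phi> \<omega> = U" for \<omega>
    by (simp add: fun_eq_iff fibre_map_def \<Phi>_def)
  have map_section: "map_section \<Phi> \<gamma> = (\<lambda>w. U (\<gamma> w))" for \<gamma>
    by (simp add: fun_eq_iff map_section_def fibre)
  have "bundle_map \<Delta> t\<^sub>1 t\<^sub>2 \<Phi>"
    unfolding bundle_map_def \<Phi>_def using t\<^sub>2
    by (auto simp: total_space_def intro!: continuous_intros continuous_on)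
  moreover have "qlinear_iso_on U (t\<^sub>1 \<omega>) (t\<^sub>2 \<omega>)" if "\<omega> \<in> \<Delta>" for \<omega>
    using lin t\<^sub>2[OF that] inj_on_inverseI[of "t\<^sub>1 \<omega>" V U] VU
    by (simp add: qlinear_iso_on_def bij_betw_def add bounded_qlinear_def)
  moreover have "cross_section \<Delta> t\<^sub>2 D (\<lambda>w. U (\<gamma> w))" if "cross_section \<Delta> t\<^sub>1 D \<gamma>" for D \<gamma>
    using that t\<^sub>2 right_holomorphic_on_bounded_qlinear[OF lin]
    by (auto simp: cross_section_def)
  moreover have "qinner ((right_deriv ^^ m) \<gamma> \<omega>) (\<eta> \<omega>) =
      qinner ((right_deriv ^^ m) (\<lambda>w. U (\<gamma> w)) \<omega>) (U (\<eta> \<omega>))"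
    if "cross_section \<Delta> t\<^sub>1 D \<gamma>" "\<omega> \<in> D" for D \<gamma> \<eta> m \<omega>
    using that higher_right_deriv_bounded_qlinear[OF lin, of \<gamma> D \<omega> m] U_qinner
    by (simp add: cross_section_def)
  ultimately show ?thesis
    unfolding equivalent_bundles_def
    by (intro exI[of _ \<Phi>]) (auto simp: fibre map_section)
qed

theorem theorem4p3:
  fixes \<Delta> :: "complex set" and n :: nat
    and t\<^sub>1 t\<^sub>2 :: "complex \<Rightarrow> 'a::quat_hilbert set"
  assumes "\<exists>B::'a set. countable B \<and> orthonormal_qbasis B"
    and "open \<Delta>" and "connected \<Delta>" and "0 < n"
    and "right_holomorphic_curve n \<Delta> t\<^sub>1" and "right_holomorphic_curve n \<Delta> t\<^sub>2"
    and "closure (qspan (\<Union>\<omega>\<in>\<Delta>. t\<^sub>1 \<omega>)) = UNIV"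
    and "closure (qspan (\<Union>\<omega>\<in>\<Delta>. t\<^sub>2 \<omega>)) = UNIV"
  shows "congruent_curves \<Delta> t\<^sub>1 t\<^sub>2 \<longleftrightarrow> equivalent_bundles \<Delta> t\<^sub>1 t\<^sub>2"
  using assms congruent_imp_equivalent equivalent_imp_congruent by blast

end
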